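(* Let $H$ be a complex Hilbert space, let $R_0\in B(H)_+$, and let $(u_n)_{n\ge 0}\subset H$ be a sequence of unit vectors. Define recursively $R_{n+1}=\Phi_{u_n}(R_n)=R_n^{1/2}(I-|u_n\rangle\langle u_n|)R_n^{1/2}$ and set $E_n=R_n^{1/2}u_n$ for all $n\ge 0$. Let $R_\infty\in B(H)_+$ be the strong limit of $(R_n)$, i.e. the unique positive operator with $\langle x,R_\infty x\rangle=\lim_{n\to\infty}\langle x,R_nx\rangle$ for all $x\in H$ (it exists). Then: (1) $R_n\downarrow R_\infty$ in the Löwner order (that is, $R_n\ge R_{n+1}\ge R_\infty$ for all $n$) and $R_n\to R_\infty$ in the strong operator topology. (2) For every $x\in H$, $\langle x,(R_0-R_\infty)x\rangle=\sum_{n=0}^\infty|\langle E_n,x\rangle|^2$, and the series converges. (3) $R_0-R_\infty=\sum_{n=0}^\infty|E_n\rangle\langle E_n|$, with convergence in the strong operator topology. (4) The vectors $E_n=R_n^{1/2}u_n$, and hence the rank-one operators $|E_n\rangle\langle E_n|$, are uniquely determined by $R_0$ and the sequence $(u_n)$. If in addition $R_0$ is trace-class, then $\operatorname{tr}(R_0-R_\infty)=\sum_{n=0}^\infty\|E_n\|^2$.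
   Context: $B(H)_+$ is the set of bounded positive operators on $H$, ordered by the Löwner order: $0\le A\le B$ iff $0\le\langle x,Ax\rangle\le\langle x,Bx\rangle$ for all $x\in H$. Inner products are linear in the second variable. $|a\rangle\langle b|$ denotes the operator $x\mapsto\langle b,x\rangle a$. For a unit vector $u$, the residual-weighted rank-one update is $\Phi_u(R)=R^{1/2}(I-|u\rangle\langle u|)R^{1/2}$ for $R\in B(H)_+$; it maps $B(H)_+$ into itself, so the recursion is well defined (if some $R_n=0$, then $R_k=0$ for all $k\ge n$). *)

theory Defs
  imports "HOL-Analysis.Analysis" "HOL-Library.Complex_Order"
begin

(* The complex structure sits on top of the real Banach space structure of the library:
   scaleC extends scaleR, and the norm is the one induced by the inner product.
   The inner product is linear in its second argument. *)
class chilbert_space = banach +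
  fixes scaleC :: "complex \<Rightarrow> 'a \<Rightarrow> 'a" (infixr "*\<^sub>C" 75)
    and cinner :: "'a \<Rightarrow> 'a \<Rightarrow> complex"
  assumes scaleC_add_right: "a *\<^sub>C (x + y) = a *\<^sub>C x + a *\<^sub>C y"
    and scaleC_add_left: "(a + b) *\<^sub>C x = a *\<^sub>C x + b *\<^sub>C x"
    and scaleC_scaleC: "a *\<^sub>C (b *\<^sub>C x) = (a * b) *\<^sub>C x"
    and scaleC_of_real: "complex_of_real r *\<^sub>C x = r *\<^sub>R x"
    and cinner_commute: "cinner x y = cnj (cinner y x)"
    and cinner_add_right: "cinner x (y + z) = cinner x y + cinner x z"
    and cinner_scaleC_right: "cinner x (a *\<^sub>C y) = a * cinner x y"
    and cinner_self: "cinner x x = complex_of_real ((norm x)\<^sup>2)"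

instantiation complex :: chilbert_space
begin

definition scaleC_complex :: "complex \<Rightarrow> complex \<Rightarrow> complex"
  where "scaleC_complex a x = a * x"

definition cinner_complex :: "complex \<Rightarrow> complex \<Rightarrow> complex"
  where "cinner_complex x y = cnj x * y"

instance
proof
  fix x :: complex
  show "cinner x x = complex_of_real ((norm x)\<^sup>2)"
    unfolding cinner_complex_def by (metis complex_norm_square mult.commute)
qed (auto simp: scaleC_complex_def cinner_complex_def algebra_simps scaleR_conv_of_real)

end

lemma scaleC_one: "1 *\<^sub>C (x :: 'a::chilbert_space) = x"
  using scaleC_of_real[of 1 x] by simp

global_interpretation complex_vector: vector_space "scaleC :: complex \<Rightarrow> 'a \<Rightarrow> 'a::chilbert_space"
  defines cspan = complex_vector.span
  by unfold_locales (simp_all add: scaleC_add_right scaleC_add_left scaleC_scaleC scaleC_one)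

lemma cinner_add_left: "cinner (x + y) z = cinner x z + cinner (y :: 'a::chilbert_space) z"
  by (metis cinner_commute cinner_add_right complex_cnj_add)

lemma cinner_scaleC_left: "cinner (a *\<^sub>C x) y = cnj a * cinner x (y :: 'a::chilbert_space)"
  by (metis cinner_commute cinner_scaleC_right complex_cnj_mult)

lemma norm_scaleC: "norm (a *\<^sub>C (x :: 'a::chilbert_space)) = cmod a * norm x"
proof -
  have "complex_of_real ((norm (a *\<^sub>C x))\<^sup>2) = (a * cnj a) * cinner x x"
    unfolding cinner_self[symmetric] cinner_scaleC_left cinner_scaleC_right by (simp add: mult_ac)
  also have "\<dots> = complex_of_real ((cmod a * norm x)\<^sup>2)"
    unfolding complex_norm_square[symmetric] cinner_self by (simp add: power_mult_distrib)
  finally have "complex_of_real ((norm (a *\<^sub>C x))\<^sup>2) = complex_of_real ((cmod a * norm x)\<^sup>2)" .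
  then have "(norm (a *\<^sub>C x))\<^sup>2 = (cmod a * norm x)\<^sup>2"
    by (simp only: of_real_eq_iff)
  then show ?thesis
    by (simp add: power2_eq_iff_nonneg)
qed

lemma cinner_Cauchy_Schwarz: "cmod (cinner x y) \<le> norm x * norm (y :: 'a::chilbert_space)"
proof (cases "y = 0")
  case True
  have "cinner x (0 :: 'a) = 0"
    using cinner_add_right[of x 0 0] by simp
  with True show ?thesis by simp
next
  case False
  define d where "d = (norm y)\<^sup>2"
  have d: "d > 0" using False by (simp add: d_def)
  define c where "c = cinner x y"
  define a where "a = - (cnj c / complex_of_real d)"
  have yx: "cinner y x = cnj c" unfolding c_def by (rule cinner_commute)
  have "complex_of_real ((norm (x + a *\<^sub>C y))\<^sup>2)
      = cinner x x + a * c + cnj a * cnj c + a * cnj a * cinner y y"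
    unfolding cinner_self[symmetric] cinner_add_left cinner_add_right cinner_scaleC_left
      cinner_scaleC_right yx c_def[symmetric]
    by (simp add: algebra_simps)
  also have "\<dots> = complex_of_real ((norm x)\<^sup>2 - (cmod c)\<^sup>2 / d)"
  proof -
    have "a * c = - complex_of_real ((cmod c)\<^sup>2 / d)"
      unfolding a_def of_real_divide complex_norm_square by simp
    moreover have "cnj a * cnj c = - complex_of_real ((cmod c)\<^sup>2 / d)"
      unfolding a_def of_real_divide complex_norm_square by simp
    moreover have "a * cnj a * cinner y y = complex_of_real ((cmod c)\<^sup>2 / d)"
      using d unfolding a_def of_real_divide complex_norm_square cinner_self d_def[symmetric]
      by simp
    ultimately show ?thesis by (simp add: cinner_self)
  qed
  finally have "(norm (x + a *\<^sub>C y))\<^sup>2 = (norm x)\<^sup>2 - (cmod c)\<^sup>2 / d"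
    by (simp only: of_real_eq_iff)
  then have "(cmod c)\<^sup>2 / d \<le> (norm x)\<^sup>2"
    by (metis diff_ge_0_iff_ge zero_le_power2)
  then have "(cmod c)\<^sup>2 \<le> (norm x * norm y)\<^sup>2"
    using d by (simp add: d_def power_mult_distrib field_simps)
  then show ?thesis
    unfolding c_def by (rule power2_le_imp_le) simp
qed

lift_definition rank_one :: "'a::chilbert_space \<Rightarrow> 'a \<Rightarrow> 'a \<Rightarrow>\<^sub>L 'a"
  is "\<lambda>a b x. cinner b x *\<^sub>C a"
proof (rule bounded_linear_intro)
  fix a b x y :: 'a and r :: real
  show "cinner b (x + y) *\<^sub>C a = cinner b x *\<^sub>C a + cinner b y *\<^sub>C a"
    by (simp add: cinner_add_right scaleC_add_left)
  show "cinner b (r *\<^sub>R x) *\<^sub>C a = r *\<^sub>R (cinner b x *\<^sub>C a)"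
    by (simp add: scaleC_of_real[symmetric] cinner_scaleC_right scaleC_scaleC)
  show "norm (cinner b x *\<^sub>C a) \<le> norm x * (norm b * norm a)"
    using mult_right_mono[OF cinner_Cauchy_Schwarz[of b x] norm_ge_zero[of a]]
    by (simp add: norm_scaleC mult_ac)
qed

(* The type of blinfuns consists of the bounded real-linear maps;
   B(H) is the subset of those that satisfy complex_linear. *)
definition complex_linear :: "('a::chilbert_space \<Rightarrow>\<^sub>L 'a) \<Rightarrow> bool"
  where "complex_linear A \<longleftrightarrow> (\<forall>c x. A (c *\<^sub>C x) = c *\<^sub>C A x)"

(* On complex numbers, z \<le> w means Re z \<le> Re w and Im z = Im w; so 0 \<le> z says that
   z is real and nonnegative. *)
definition positive_op :: "('a::chilbert_space \<Rightarrow>\<^sub>L 'a) \<Rightarrow> bool"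
  where "positive_op A \<longleftrightarrow> complex_linear A \<and> (\<forall>x. 0 \<le> cinner x (A x))"

definition loewner_le :: "('a::chilbert_space \<Rightarrow>\<^sub>L 'a) \<Rightarrow> ('a \<Rightarrow>\<^sub>L 'a) \<Rightarrow> bool" (infix "\<le>\<^sub>L" 50)
  where "A \<le>\<^sub>L B \<longleftrightarrow>
    positive_op A \<and> positive_op B \<and> (\<forall>x. cinner x (A x) \<le> cinner x (B x))"

definition is_sqrt_op :: "('a::chilbert_space \<Rightarrow>\<^sub>L 'a) \<Rightarrow> ('a \<Rightarrow>\<^sub>L 'a) \<Rightarrow> bool"
  where "is_sqrt_op R S \<longleftrightarrow> positive_op S \<and> S o\<^sub>L S = R"

definition sqrt_op :: "('a::chilbert_space \<Rightarrow>\<^sub>L 'a) \<Rightarrow> ('a \<Rightarrow>\<^sub>L 'a)"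
  where "sqrt_op R = (THE S. is_sqrt_op R S)"

definition residual_update :: "'a::chilbert_space \<Rightarrow> ('a \<Rightarrow>\<^sub>L 'a) \<Rightarrow> ('a \<Rightarrow>\<^sub>L 'a)"
  where "residual_update u R = sqrt_op R o\<^sub>L (id_blinfun - rank_one u u) o\<^sub>L sqrt_op R"

definition adjoint_op :: "('a::chilbert_space \<Rightarrow>\<^sub>L 'a) \<Rightarrow> ('a \<Rightarrow>\<^sub>L 'a)"
  where "adjoint_op A = (THE B :: 'a \<Rightarrow>\<^sub>L 'a. \<forall>x y. cinner x (A y) = cinner (B x) y)"

definition abs_op :: "('a::chilbert_space \<Rightarrow>\<^sub>L 'a) \<Rightarrow> ('a \<Rightarrow>\<^sub>L 'a)"
  where "abs_op A = sqrt_op (adjoint_op A o\<^sub>L A)"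

definition orthonormal_basis :: "'a::chilbert_space set \<Rightarrow> bool"
  where "orthonormal_basis B \<longleftrightarrow>
    (\<forall>e\<in>B. \<forall>f\<in>B. cinner e f = (if e = f then 1 else 0)) \<and> closure (cspan B) = UNIV"

definition trace_class :: "('a::chilbert_space \<Rightarrow>\<^sub>L 'a) \<Rightarrow> bool"
  where "trace_class A \<longleftrightarrow> complex_linear A \<and>
    (\<exists>B. orthonormal_basis B \<and> (\<lambda>e. cinner e (abs_op A e)) summable_on B)"

(* For a trace-class operator the value does not depend on the orthonormal basis. *)
definition trace_op :: "('a::chilbert_space \<Rightarrow>\<^sub>L 'a) \<Rightarrow> complex"
  where "trace_op A = (\<Sum>\<^sub>\<infinity>e\<in>(SOME B. orthonormal_basis B). cinner e (A e))"

definition is_residual_limit :: "(nat \<Rightarrow> 'a::chilbert_space \<Rightarrow>\<^sub>L 'a) \<Rightarrow> ('a \<Rightarrow>\<^sub>L 'a) \<Rightarrow> bool"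
  where "is_residual_limit R S \<longleftrightarrow>
    positive_op S \<and> (\<forall>x. (\<lambda>n. cinner x (R n x)) \<longlonglongrightarrow> cinner x (S x))"

(* A run of the recursion with initial operator R0. The operators S n stand for the square
   roots of the R n; they are specified relationally, so that it is not built into this
   definition that a run is determined by R0 and u. *)
definition residual_run ::
  "('a::chilbert_space \<Rightarrow>\<^sub>L 'a) \<Rightarrow> (nat \<Rightarrow> 'a) \<Rightarrow> (nat \<Rightarrow> 'a \<Rightarrow>\<^sub>L 'a) \<Rightarrow> (nat \<Rightarrow> 'a \<Rightarrow>\<^sub>L 'a) \<Rightarrow> (nat \<Rightarrow> 'a) \<Rightarrow> bool"
  where "residual_run R0 u R S E \<longleftrightarrow> R 0 = R0 \<and>
    (\<forall>n. is_sqrt_op (R n) (S n) \<and>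
         R (Suc n) = S n o\<^sub>L (id_blinfun - rank_one (u n) (u n)) o\<^sub>L S n \<and>
         E n = S n (u n))"

end

theory Submission
  imports Defs
begin

text \<open>
  Let \<open>S\<^sub>n\<close> be the positive square root of \<open>R\<^sub>n\<close>. Since \<open>S\<^sub>n\<close> is self-adjoint,
  \<open>S\<^sub>n (1 - \<bar>u\<^sub>n\<rangle>\<langle>u\<^sub>n\<bar>) S\<^sub>n = R\<^sub>n - \<bar>E\<^sub>n\<rangle>\<langle>E\<^sub>n\<bar>\<close> (\<open>residual_step_eq_diff\<close>). So one step subtracts a
  positive rank-one operator, and it leaves a positive operator because \<open>1 - \<bar>u\<^sub>n\<rangle>\<langle>u\<^sub>n\<bar> \<ge> 0\<close>. The
  residuals form a decreasing sequence of positive operators, and the partial sums of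
  \<open>\<Sum>\<^sub>n \<bar>E\<^sub>n\<rangle>\<langle>E\<^sub>n\<bar>\<close> telescope to \<open>R\<^sub>0 - R\<^sub>N\<close>. Everything about the limit follows from the convergence
  theorem for such sequences (\<open>positive_decreasing_converges\<close>): the quadratic forms decrease to
  limits, and \<open>\<parallel>A x\<parallel>\<^sup>2 \<le> \<parallel>A\<parallel> \<langle>x, A x\<rangle>\<close> for \<open>A \<ge> 0\<close> upgrades this to strong convergence. A limit
  specified through quadratic forms is unique by polarization.

  The vectors \<open>E\<^sub>n\<close> are determined because each positive operator has exactly one positive square
  root (\<open>positive_sqrt_ex1\<close>). Existence comes, without functional calculus, from the monotone
  iteration \<open>Y \<mapsto> (B + Y\<^sup>2) / 2\<close> with \<open>B = 1 - A\<close>, once \<open>A\<close> is scaled to norm at most 1. Its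
  iterates and increments are polynomials in
  \<open>B\<close> with nonnegative coefficients. They are therefore positive, and the same convergence theorem
  applies. The root obtained in this way commutes with everything that commutes with \<open>A\<close>, which
  gives uniqueness.

  For the trace, the double sum of \<open>\<bar>\<langle>E\<^sub>n, e\<rangle>\<bar>\<^sup>2\<close> over \<open>n\<close> and over an orthonormal basis is evaluated in
  both orders: one gives the diagonal sum of \<open>R\<^sub>0 - R\<^sub>\<infinity>\<close>, the other, by Parseval's identity,
  \<open>\<Sum>\<^sub>n \<parallel>E\<^sub>n\<parallel>\<^sup>2\<close> (\<open>diagonal_has_sum_iff\<close>). The latter does not mention the basis, so the basis that
  witnesses the trace-class property may be exchanged for the one that defines the trace.
\<close>

section \<open>Inner products and positive operators\<close>

lemma bounded_bilinear_cinner: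
  "bounded_bilinear (cinner :: 'a::chilbert_space \<Rightarrow> 'a \<Rightarrow> complex)"
proof
  fix a b c :: 'a and r :: real
  show "cinner (a + b) c = cinner a c + cinner b c" by (rule cinner_add_left)
  show "cinner a (b + c) = cinner a b + cinner a c" by (rule cinner_add_right)
  show "cinner (r *\<^sub>R a) b = r *\<^sub>R cinner a b"
    using cinner_scaleC_left[of "of_real r" a b] by (simp add: scaleC_of_real scaleR_conv_of_real)
  show "cinner a (r *\<^sub>R b) = r *\<^sub>R cinner a b"
    using cinner_scaleC_right[of a "of_real r" b] by (simp add: scaleC_of_real scaleR_conv_of_real)
  show "\<exists>K. \<forall>a b::'a. norm (cinner a b) \<le> norm a * norm b * K"
    by (rule exI[of _ 1]) (simp add: cinner_Cauchy_Schwarz)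
qed

interpretation cinner: bounded_bilinear "cinner :: 'a::chilbert_space \<Rightarrow> 'a \<Rightarrow> complex"
  by (rule bounded_bilinear_cinner)

lemma bounded_bilinear_scaleC:
  "bounded_bilinear (scaleC :: complex \<Rightarrow> 'a::chilbert_space \<Rightarrow> 'a)"
proof
  fix a a' :: complex and b b' :: 'a and r :: real
  show "(a + a') *\<^sub>C b = a *\<^sub>C b + a' *\<^sub>C b" by (rule scaleC_add_left)
  show "a *\<^sub>C (b + b') = a *\<^sub>C b + a *\<^sub>C b'" by (rule scaleC_add_right)
  have "(r *\<^sub>R a) *\<^sub>C b = complex_of_real r *\<^sub>C (a *\<^sub>C b)"
    by (simp only: scaleC_scaleC scaleR_conv_of_real)
  then show "(r *\<^sub>R a) *\<^sub>C b = r *\<^sub>R (a *\<^sub>C b)"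
    by (simp only: scaleC_of_real)
  have "a *\<^sub>C (complex_of_real r *\<^sub>C b) = complex_of_real r *\<^sub>C (a *\<^sub>C b)"
    by (simp only: scaleC_scaleC mult.commute)
  then show "a *\<^sub>C (r *\<^sub>R b) = r *\<^sub>R (a *\<^sub>C b)"
    by (simp only: scaleC_of_real)
  show "\<exists>K. \<forall>a (b::'a). norm (a *\<^sub>C b) \<le> norm a * norm b * K"
    by (rule exI[of _ 1]) (simp add: norm_scaleC)
qed

interpretation scaleC: bounded_bilinear "scaleC :: complex \<Rightarrow> 'a::chilbert_space \<Rightarrow> 'a"
  by (rule bounded_bilinear_scaleC)

lemma Re_cinner_self: "Re (cinner x x) = (norm (x :: 'a::chilbert_space))\<^sup>2"
  by (simp add: cinner_self)

lemma Re_cinner_le: "Re (cinner x y) \<le> norm x * norm (y :: 'a::chilbert_space)"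
  using complex_Re_le_cmod[of "cinner x y"] cinner_Cauchy_Schwarz[of x y] by linarith

lemma rank_one_apply: "rank_one a b x = cinner b x *\<^sub>C a"
  by (simp add: rank_one.rep_eq)

lemma complex_linearD: "complex_linear A \<Longrightarrow> A (c *\<^sub>C x) = c *\<^sub>C A x"
  by (simp add: complex_linear_def)

lemma complex_linear_algebra:
  fixes A B :: "'a::chilbert_space \<Rightarrow>\<^sub>L 'a"
  shows "complex_linear (id_blinfun :: 'a \<Rightarrow>\<^sub>L 'a)"
  "complex_linear (0 :: 'a \<Rightarrow>\<^sub>L 'a)"
  "complex_linear A \<Longrightarrow> complex_linear B \<Longrightarrow> complex_linear (A + B)"
  "complex_linear A \<Longrightarrow> complex_linear B \<Longrightarrow> complex_linear (A - B)"
  "complex_linear A \<Longrightarrow> complex_linear (r *\<^sub>R A)"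
  "complex_linear A \<Longrightarrow> complex_linear B \<Longrightarrow> complex_linear (A o\<^sub>L B)"
  by (simp_all add: complex_linear_def blinfun.bilinear_simps scaleC.add_right scaleC.diff_right
      scaleC.scaleR_right scaleC.zero_right)

lemma sesquilinear_expand:
  fixes A :: "'a::chilbert_space \<Rightarrow>\<^sub>L 'a"
  assumes "complex_linear A"
  shows "cinner (x + y) (A (x + y)) = cinner x (A x) + cinner y (A y) + (cinner x (A y) + cinner y (A x))"
    and "cinner (x + \<i> *\<^sub>C y) (A (x + \<i> *\<^sub>C y))
      = cinner x (A x) + cinner y (A y) + \<i> * (cinner x (A y) - cinner y (A x))"
  using assms
  by (simp_all add: complex_linearD blinfun.add_right cinner_add_left cinner_add_right
      cinner_scaleC_left cinner_scaleC_right algebra_simps)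

text \<open>By polarization at \<open>x + y\<close> and \<open>x + \<i> y\<close>. The complex scalars matter: on the real plane the
  rotation by a right angle has the zero form.\<close>

lemma quadratic_form_zero_imp_zero:
  fixes A :: "'a::chilbert_space \<Rightarrow>\<^sub>L 'a"
  assumes lin: "complex_linear A" and zero: "\<And>x. cinner x (A x) = 0"
  shows "A = 0"
proof (rule blinfun_eqI)
  fix y
  define x where "x = A y"
  have "cinner x (A y) + cinner y (A x) = 0" "cinner x (A y) - cinner y (A x) = 0"
    using sesquilinear_expand[OF lin, of x y] by (simp_all add: zero)
  then have "cinner x (A y) = 0" by simp
  then show "A y = blinfun_apply 0 y" by (simp add: x_def cinner_self)
qed

lemma quadratic_form_inject:
  fixes A B :: "'a::chilbert_space \<Rightarrow>\<^sub>L 'a"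
  assumes "complex_linear A" "complex_linear B" "\<And>x. cinner x (A x) = cinner x (B x)"
  shows "A = B"
  using quadratic_form_zero_imp_zero[of "A - B"] assms
  by (simp add: complex_linear_algebra blinfun.diff_left cinner.diff_right)

lemma positive_op_complex_linear: "positive_op A \<Longrightarrow> complex_linear A"
  by (simp add: positive_op_def)

lemma positive_op_Re: "positive_op A \<Longrightarrow> 0 \<le> Re (cinner x (A x))"
  by (simp add: positive_op_def less_eq_complex_def)

text \<open>Positive operators are self-adjoint: the form takes real values at \<open>x + y\<close> and at
  \<open>x + \<i> y\<close>, which gives the imaginary and the real part of the identity.\<close>

lemma positive_op_selfadjoint:
  fixes A :: "'a::chilbert_space \<Rightarrow>\<^sub>L 'a"
  assumes "positive_op A"
  shows "cinner x (A y) = cinner (A x) y"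
proof -
  have lin: "complex_linear A" and im: "Im (cinner z (A z)) = 0" for z
    using assms by (simp_all add: positive_op_def less_eq_complex_def)
  have "Im (cinner x (A y) + cinner y (A x)) = 0" "Re (cinner x (A y) - cinner y (A x)) = 0"
    using sesquilinear_expand[OF lin, of x y] im[of x] im[of y] im[of "x + y"]
      im[of "x + \<i> *\<^sub>C y"] by simp_all
  then have "cinner x (A y) = cnj (cinner y (A x))"
    by (simp add: complex_eq_iff)
  then show ?thesis using cinner_commute[of "A x" y] by simp
qed

lemma positive_opI:
  fixes A :: "'a::chilbert_space \<Rightarrow>\<^sub>L 'a"
  assumes "complex_linear A" "\<And>x y. cinner x (A y) = cinner (A x) y"
    "\<And>x. 0 \<le> Re (cinner x (A x))"
  shows "positive_op A"
proof -
  have "Im (cinner x (A x)) = 0" for x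
    using cinner_commute[of x "A x"] assms(2)[of x x] by (simp add: complex_eq_iff)
  with assms show ?thesis by (simp add: positive_op_def less_eq_complex_def)
qed

lemma positive_op_cinner_real:
  "positive_op A \<Longrightarrow> cinner x (A x) = complex_of_real (Re (cinner x (A x)))"
  by (simp add: positive_op_def less_eq_complex_def complex_eq_iff)

lemma positive_op_algebra:
  fixes A B :: "'a::chilbert_space \<Rightarrow>\<^sub>L 'a"
  shows "positive_op (id_blinfun :: 'a \<Rightarrow>\<^sub>L 'a)" "positive_op (0 :: 'a \<Rightarrow>\<^sub>L 'a)"
    and "positive_op A \<Longrightarrow> positive_op B \<Longrightarrow> positive_op (A + B)"
    and "positive_op A \<Longrightarrow> 0 \<le> r \<Longrightarrow> positive_op (r *\<^sub>R A)"
    and "positive_op A \<Longrightarrow> positive_op B \<Longrightarrow> positive_op (B o\<^sub>L A o\<^sub>L B)"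
proof -
  show "positive_op (id_blinfun :: 'a \<Rightarrow>\<^sub>L 'a)" "positive_op (0 :: 'a \<Rightarrow>\<^sub>L 'a)"
    by (rule positive_opI; simp add: complex_linear_algebra cinner.zero_left cinner.zero_right
        Re_cinner_self)+
  show "positive_op (A + B)" if "positive_op A" "positive_op B"
    using that positive_op_selfadjoint[OF that(1)] positive_op_selfadjoint[OF that(2)]
      positive_op_Re[OF that(1)] positive_op_Re[OF that(2)]
    by (intro positive_opI complex_linear_algebra)
      (auto simp only: positive_op_complex_linear blinfun.add_left cinner_add_left
        cinner_add_right plus_complex.sel intro: add_nonneg_nonneg)
  show "positive_op (r *\<^sub>R A)" if "positive_op A" "0 \<le> r"
    using that positive_op_selfadjoint[OF that(1)] positive_op_Re[OF that(1)]
    by (intro positive_opI complex_linear_algebra)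
      (auto simp only: positive_op_complex_linear blinfun.scaleR_left cinner.scaleR_left
        cinner.scaleR_right scaleR_complex.sel intro: mult_nonneg_nonneg)
  show "positive_op (B o\<^sub>L A o\<^sub>L B)" if "positive_op A" "positive_op B"
  proof (rule positive_opI)
    show "complex_linear (B o\<^sub>L A o\<^sub>L B)"
      using that by (simp add: complex_linear_algebra positive_op_complex_linear)
    have *: "cinner x ((B o\<^sub>L A o\<^sub>L B) y) = cinner (B x) (A (B y))" for x y
      using that by (simp add: positive_op_selfadjoint)
    show "cinner x ((B o\<^sub>L A o\<^sub>L B) y) = cinner ((B o\<^sub>L A o\<^sub>L B) x) y" for x y
      using that by (simp add: positive_op_selfadjoint)
    show "0 \<le> Re (cinner x ((B o\<^sub>L A o\<^sub>L B) x))" for x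
      unfolding * using that by (simp add: positive_op_Re)
  qed
qed

lemma positive_op_id_minus:
  fixes A :: "'a::chilbert_space \<Rightarrow>\<^sub>L 'a"
  assumes "complex_linear A" "\<And>x y. cinner x (A y) = cinner (A x) y" "norm A \<le> 1"
  shows "positive_op (id_blinfun - A)"
proof (rule positive_opI)
  show "complex_linear (id_blinfun - A)" using assms by (simp add: complex_linear_algebra)
  show "cinner x ((id_blinfun - A) y) = cinner ((id_blinfun - A) x) y" for x y
    using assms(2) by (simp add: blinfun.diff_left cinner.diff_left cinner.diff_right)
  fix x
  have "norm (A x) \<le> norm x"
    using norm_blinfun[of A x] mult_right_mono[OF assms(3) norm_ge_zero[of x]] by simp
  then have "norm x * norm (A x) \<le> norm x * norm x"
    by (intro mult_left_mono norm_ge_zero)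
  then have "Re (cinner x (A x)) \<le> norm x * norm x"
    using Re_cinner_le[of x "A x"] by simp
  then show "0 \<le> Re (cinner x ((id_blinfun - A) x))"
    by (simp add: blinfun.diff_left cinner.diff_right Re_cinner_self power2_eq_square)
qed

text \<open>This lets the quadratic form of a positive operator control the operator itself. It is what
  the Cauchy--Schwarz inequality for the form \<open>\<langle>x, A y\<rangle>\<close> gives at \<open>y = A x\<close>.\<close>

lemma positive_op_norm_sq_le:
  fixes A :: "'a::chilbert_space \<Rightarrow>\<^sub>L 'a"
  assumes "positive_op A"
  shows "(norm (A x))\<^sup>2 \<le> norm A * Re (cinner x (A x))"
proof (cases "A = 0")
  case False
  define M where "M = norm A"
  define N where "N = (norm (A x))\<^sup>2"
  have M: "M > 0" using False by (simp add: M_def)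
  \<comment> \<open>The form at \<open>x - t A x\<close> is at most \<open>\<langle>x, A x\<rangle> - 2 t N + t\<^sup>2 M N\<close>; this is smallest at
    \<open>t = 1 / M\<close>.\<close>
  define t where "t = 1 / M"
  have sa: "cinner x (A (A x)) = cinner (A x) (A x)"
    by (rule positive_op_selfadjoint[OF assms])
  have "Re (cinner (A x) (A (A x))) \<le> norm (A x) * (M * norm (A x))"
    unfolding M_def
    by (rule order_trans[OF Re_cinner_le]) (intro mult_left_mono norm_blinfun norm_ge_zero)
  then have q: "Re (cinner (A x) (A (A x))) \<le> M * N"
    by (simp add: N_def power2_eq_square mult_ac)
  have "0 \<le> Re (cinner (x - t *\<^sub>R A x) (A (x - t *\<^sub>R A x)))"
    by (rule positive_op_Re[OF assms])
  also have "\<dots> = Re (cinner x (A x)) - 2 * t * N + t * t * Re (cinner (A x) (A (A x)))"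
    by (simp add: blinfun.diff_right blinfun.scaleR_right cinner.diff_left cinner.diff_right
        cinner.scaleR_left cinner.scaleR_right sa Re_cinner_self N_def algebra_simps)
  also have "\<dots> \<le> Re (cinner x (A x)) - 2 * t * N + t * t * (M * N)"
    using q by (intro add_left_mono mult_left_mono) auto
  also have "\<dots> = Re (cinner x (A x)) - N / M"
    using M by (simp add: t_def field_simps)
  finally show ?thesis using M by (simp add: field_simps N_def M_def)
qed simp

text \<open>The preceding inequality gives \<open>\<parallel>A\<parallel>\<^sup>2 \<le> \<parallel>A\<parallel> K\<close>. So the form of a positive operator bounds its
  norm, and the norm is monotone in the order of forms.\<close>

lemma positive_op_norm_bound:
  fixes A :: "'a::chilbert_space \<Rightarrow>\<^sub>L 'a"
  assumes "positive_op A" "0 \<le> K" "\<And>x. Re (cinner x (A x)) \<le> K * (norm x)\<^sup>2"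
  shows "norm A \<le> K"
proof (cases "A = 0")
  case False
  have "norm (A x) \<le> sqrt (norm A * K) * norm x" for x
  proof -
    have "(norm (A x))\<^sup>2 \<le> norm A * (K * (norm x)\<^sup>2)"
      by (rule order_trans[OF positive_op_norm_sq_le[OF assms(1)]])
        (intro mult_left_mono assms(3) norm_ge_zero)
    then have "norm (A x) \<le> sqrt (norm A * (K * (norm x)\<^sup>2))"
      by (rule real_le_rsqrt)
    then show ?thesis
      by (simp add: real_sqrt_mult mult.assoc)
  qed
  then have "norm A \<le> sqrt (norm A * K)"
    using assms(2) by (intro norm_blinfun_bound) auto
  then have "(norm A)\<^sup>2 \<le> (sqrt (norm A * K))\<^sup>2"
    by (rule power_mono) simp
  then have "norm A * norm A \<le> norm A * K"
    using assms(2) by (simp add: power2_eq_square)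
  then show ?thesis using False by simp
qed (use assms in simp)

lemma loewner_imp_norm_le:
  fixes A B :: "'a::chilbert_space \<Rightarrow>\<^sub>L 'a"
  assumes "positive_op A" "\<And>x. Re (cinner x (A x)) \<le> Re (cinner x (B x))"
  shows "norm A \<le> norm B"
proof (rule positive_op_norm_bound[OF assms(1) norm_ge_zero])
  fix x
  have "norm x * norm (B x) \<le> norm x * (norm B * norm x)"
    by (intro mult_left_mono norm_blinfun norm_ge_zero)
  then show "Re (cinner x (A x)) \<le> norm B * (norm x)\<^sup>2"
    using assms(2)[of x] Re_cinner_le[of x "B x"] by (simp add: power2_eq_square mult_ac)
qed

section \<open>Strong limits of decreasing sequences\<close>

text \<open>The numbers \<open>\<langle>x, T\<^sub>n x\<rangle>\<close> decrease and are bounded below, hence Cauchy. For \<open>n \<le> m\<close> the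
  difference \<open>T\<^sub>n - T\<^sub>m\<close> is positive with norm at most \<open>2 \<parallel>T\<^sub>0\<parallel>\<close>, so that
  \<open>\<parallel>(T\<^sub>n - T\<^sub>m) x\<parallel>\<^sup>2\<close> is at most \<open>2 \<parallel>T\<^sub>0\<parallel>\<close> times the difference of these numbers, and the vectors
  \<open>T\<^sub>n x\<close> are Cauchy as well.\<close>

lemma positive_decreasing_converges:
  fixes T :: "nat \<Rightarrow> 'a::chilbert_space \<Rightarrow>\<^sub>L 'a"
  assumes pos: "\<And>n. positive_op (T n)"
    and dec: "\<And>n. positive_op (T n - T (Suc n))"
  obtains L where "positive_op L" "\<And>x. (\<lambda>n. T n x) \<longlonglongrightarrow> L x"
proof -
  define q where "q n x = Re (cinner x (T n x))" for n x
  have decr: "decseq (\<lambda>n. q n x)" for x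
  proof (rule decseq_SucI)
    show "q (Suc n) x \<le> q n x" for n
      using positive_op_Re[OF dec, of x n]
      by (simp add: q_def blinfun.diff_left cinner.diff_right)
  qed
  have bound: "norm (T n) \<le> norm (T 0)" for n
    using decr pos by (intro loewner_imp_norm_le) (auto simp: q_def decseq_def)
  have diff_pos: "positive_op (T n - T (n + k))" for n k
  proof (induction k)
    case (Suc k)
    then show ?case using positive_op_algebra(3)[OF Suc dec[of "n + k"]] by simp
  qed (simp add: positive_op_algebra)
  have step: "(norm (T n x - T m x))\<^sup>2 \<le> 2 * norm (T 0) * (q n x - q m x)" if "n \<le> m" for n m x
  proof -
    have p: "positive_op (T n - T m)" using diff_pos[of n "m - n"] that by simp
    have "(norm ((T n - T m) x))\<^sup>2 \<le> norm (T n - T m) * Re (cinner x ((T n - T m) x))"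
      by (rule positive_op_norm_sq_le[OF p])
    also have "\<dots> \<le> (2 * norm (T 0)) * Re (cinner x ((T n - T m) x))"
      using norm_triangle_ineq4[of "T n" "T m"] bound[of n] bound[of m]
      by (intro mult_right_mono positive_op_Re[OF p]) linarith
    finally show ?thesis by (simp add: q_def blinfun.diff_left cinner.diff_right)
  qed
  have conv: "convergent (\<lambda>n. T n x)" for x
  proof -
    have "convergent (\<lambda>n. q n x)"
      using decr positive_op_Re[OF pos]
      by (auto intro!: decseq_imp_monoseq Bseq_monoseq_convergent decseq_bounded simp: q_def)
    then have C: "Cauchy (\<lambda>n. q n x)" by (rule convergent_Cauchy)
    have "Cauchy (\<lambda>n. T n x)"
    proof (rule metric_CauchyI)
      fix e :: real assume e: "e > 0"
      \<comment> \<open>The added 1 covers the case \<open>T\<^sub>0 = 0\<close>.\<close>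
      define d where "d = e\<^sup>2 / (2 * norm (T 0) + 1)"
      have d: "d > 0" using e by (simp add: d_def add_nonneg_pos)
      obtain M where M: "\<And>m n. m \<ge> M \<Longrightarrow> n \<ge> M \<Longrightarrow> dist (q m x) (q n x) < d"
        using metric_CauchyD[OF C d] by blast
      have main: "dist (T n x) (T m x) < e" if "M \<le> n" "n \<le> m" for n m
      proof -
        have "(norm (T n x - T m x))\<^sup>2 \<le> 2 * norm (T 0) * (q n x - q m x)"
          by (rule step[OF that(2)])
        also have "\<dots> \<le> 2 * norm (T 0) * d"
          using M[of n m] that by (intro mult_left_mono) (auto simp: dist_real_def)
        also have "\<dots> < (2 * norm (T 0) + 1) * d" using d by simp
        also have "\<dots> = e\<^sup>2"
          using add_nonneg_pos[of "2 * norm (T 0)" 1] unfolding d_def by simp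
        finally show ?thesis unfolding dist_norm
          by (rule power_less_imp_less_base) (use e in simp)
      qed
      show "\<exists>M. \<forall>m\<ge>M. \<forall>n\<ge>M. dist (T m x) (T n x) < e"
        using main by (metis dist_commute nle_le)
    qed
    then show ?thesis by (rule Cauchy_convergent)
  qed
  define g where "g x = lim (\<lambda>n. T n x)" for x
  have g: "(\<lambda>n. T n x) \<longlonglongrightarrow> g x" for x
    using conv convergent_LIMSEQ_iff by (auto simp: g_def)
  have bl: "bounded_linear g"
  proof (rule bounded_linear_intro)
    fix x y :: 'a and r :: real
    show "g (x + y) = g x + g y"
      by (rule LIMSEQ_unique[OF g]) (simp add: blinfun.add_right tendsto_add g)
    show "g (r *\<^sub>R x) = r *\<^sub>R g x"
      by (rule LIMSEQ_unique[OF g]) (simp add: blinfun.scaleR_right tendsto_scaleR g)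
    show "norm (g x) \<le> norm x * norm (T 0)"
    proof (rule LIMSEQ_le_const2[OF tendsto_norm[OF g]])
      have "norm (T n x) \<le> norm x * norm (T 0)" for n
        using norm_blinfun[of "T n" x] mult_right_mono[OF bound[of n] norm_ge_zero[of x]]
        by (simp add: mult.commute)
      then show "\<exists>N. \<forall>n\<ge>N. norm (T n x) \<le> norm x * norm (T 0)" by blast
    qed
  qed
  define L where "L = Blinfun g"
  have L: "blinfun_apply L = g" unfolding L_def by (rule bounded_linear_Blinfun_apply[OF bl])
  have "positive_op L"
  proof (rule positive_opI)
    show "complex_linear L" unfolding complex_linear_def L
    proof (intro allI)
      fix c x
      have "(\<lambda>n. c *\<^sub>C T n x) \<longlonglongrightarrow> c *\<^sub>C g x" by (intro scaleC.tendsto tendsto_const g)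
      then show "g (c *\<^sub>C x) = c *\<^sub>C g x"
        using LIMSEQ_unique[OF g[of "c *\<^sub>C x"]] positive_op_complex_linear[OF pos]
        by (simp add: complex_linearD)
    qed
    fix x y
    have lim: "(\<lambda>n. cinner x (T n y)) \<longlonglongrightarrow> cinner x (g y)" for x y
      by (intro cinner.tendsto tendsto_const g)
    have "(\<lambda>n. cinner (T n x) y) \<longlonglongrightarrow> cinner (g x) y"
      by (intro cinner.tendsto tendsto_const g)
    then show "cinner x (L y) = cinner (L x) y"
      using LIMSEQ_unique[OF lim[of x y]] pos by (simp add: positive_op_selfadjoint L)
    show "0 \<le> Re (cinner x (L x))" unfolding L
      by (rule LIMSEQ_le_const[OF tendsto_Re[OF lim]]) (use positive_op_Re[OF pos] in auto)
  qed
  with g show thesis by (auto intro!: that simp: L)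
qed

lemma limitin_strong_operator_topologyI:
  fixes T :: "'i \<Rightarrow> 'a::real_normed_vector \<Rightarrow>\<^sub>L 'b::real_normed_vector" and L :: "'a \<Rightarrow>\<^sub>L 'b"
  assumes "\<And>x. ((\<lambda>n. T n x) \<longlongrightarrow> L x) F"
  shows "limitin strong_operator_topology T L F"
  unfolding limitin_def
proof (intro conjI allI impI)
  show "L \<in> topspace strong_operator_topology"
    by (simp add: strong_operator_topology_topspace)
  fix U assume U: "openin strong_operator_topology U \<and> L \<in> U"
  then obtain V where V: "open V" "U = blinfun_apply -` V"
    by (auto simp: strong_operator_topology_def openin_pullback_topology)
  have "((\<lambda>n. blinfun_apply (T n)) \<longlongrightarrow> blinfun_apply L) F"
    unfolding limitin_canonical_iff[symmetric] euclidean_product_topology[symmetric]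
    using assms by (simp add: limitin_componentwise)
  then have "\<forall>\<^sub>F n in F. blinfun_apply (T n) \<in> V"
    using V U by (auto dest: topological_tendstoD)
  then show "\<forall>\<^sub>F n in F. T n \<in> U" by (simp add: V)
qed

section \<open>Square roots of positive operators\<close>

text \<open>The polynomials in \<open>B\<close> with nonnegative coefficients. The sandwich rule produces the
  powers of \<open>B\<close> two degrees at a time, which makes positivity an immediate induction; closure
  under products is then the derived fact.\<close>

inductive nonneg_polynomial :: "('a::chilbert_space \<Rightarrow>\<^sub>L 'a) \<Rightarrow> ('a \<Rightarrow>\<^sub>L 'a) \<Rightarrow> bool"
  for B where
  zero: "nonneg_polynomial B 0"
| one: "nonneg_polynomial B id_blinfun"
| self: "nonneg_polynomial B B"
| add: "nonneg_polynomial B P \<Longrightarrow> nonneg_polynomial B Q \<Longrightarrow> nonneg_polynomial B (P + Q)"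
| scale: "nonneg_polynomial B P \<Longrightarrow> 0 \<le> r \<Longrightarrow> nonneg_polynomial B (r *\<^sub>R P)"
| sandwich: "nonneg_polynomial B P \<Longrightarrow> nonneg_polynomial B (B o\<^sub>L P o\<^sub>L B)"

lemma nonneg_polynomial_positive:
  "nonneg_polynomial B P \<Longrightarrow> positive_op B \<Longrightarrow> positive_op P"
  by (induction rule: nonneg_polynomial.induct) (simp_all add: positive_op_algebra)

lemma nonneg_polynomial_compose_self:
  assumes "nonneg_polynomial B P"
  shows "nonneg_polynomial B (B o\<^sub>L P)"
  using assms
proof (induction rule: nonneg_polynomial.induct)
  case self
  have "B o\<^sub>L B = B o\<^sub>L id_blinfun o\<^sub>L B" by (rule blinfun_eqI) simp
  then show ?case using nonneg_polynomial.sandwich[OF nonneg_polynomial.one, of B] by simp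
next
  case one
  have "B o\<^sub>L id_blinfun = B" by (rule blinfun_eqI) simp
  then show ?case by (simp add: nonneg_polynomial.self)
next
  case (add P Q)
  have "B o\<^sub>L (P + Q) = (B o\<^sub>L P) + (B o\<^sub>L Q)"
    by (rule blinfun_eqI) (simp add: blinfun.bilinear_simps)
  with add show ?case by (simp add: nonneg_polynomial.add)
next
  case (scale P r)
  have "B o\<^sub>L (r *\<^sub>R P) = r *\<^sub>R (B o\<^sub>L P)"
    by (rule blinfun_eqI) (simp add: blinfun.bilinear_simps)
  with scale show ?case by (simp add: nonneg_polynomial.scale)
next
  case (sandwich P)
  have "B o\<^sub>L (B o\<^sub>L P o\<^sub>L B) = B o\<^sub>L (B o\<^sub>L P) o\<^sub>L B"
    by (rule blinfun_eqI) simp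
  then show ?case using nonneg_polynomial.sandwich[OF sandwich.IH] by (simp only:)
qed (simp add: nonneg_polynomial.zero)

lemma nonneg_polynomial_compose:
  assumes "nonneg_polynomial B P" "nonneg_polynomial B Q"
  shows "nonneg_polynomial B (P o\<^sub>L Q)"
  using assms
proof (induction arbitrary: Q rule: nonneg_polynomial.induct)
  case one
  have "id_blinfun o\<^sub>L Q = Q" by (rule blinfun_eqI) simp
  with one show ?case by simp
next
  case (add P P')
  have "(P + P') o\<^sub>L Q = (P o\<^sub>L Q) + (P' o\<^sub>L Q)"
    by (rule blinfun_eqI) (simp add: blinfun.bilinear_simps)
  with add show ?case by (simp add: nonneg_polynomial.add)
next
  case (scale P r)
  have "(r *\<^sub>R P) o\<^sub>L Q = r *\<^sub>R (P o\<^sub>L Q)"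
    by (rule blinfun_eqI) (simp add: blinfun.bilinear_simps)
  with scale show ?case by (simp add: nonneg_polynomial.scale)
next
  case (sandwich P)
  have "(B o\<^sub>L P o\<^sub>L B) o\<^sub>L Q = B o\<^sub>L (P o\<^sub>L (B o\<^sub>L Q))"
    by (rule blinfun_eqI) simp
  with sandwich show ?case by (simp add: nonneg_polynomial_compose_self)
qed (simp_all add: nonneg_polynomial.zero nonneg_polynomial_compose_self)

text \<open>Iteration for the solution \<open>Y\<close> of \<open>Y = (B + Y\<^sup>2) / 2\<close>, that is, of
  \<open>(1 - Y)\<^sup>2 = 1 - B\<close>.\<close>

primrec sqrt_iteration :: "('a::chilbert_space \<Rightarrow>\<^sub>L 'a) \<Rightarrow> nat \<Rightarrow> 'a \<Rightarrow>\<^sub>L 'a" where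
  "sqrt_iteration B 0 = 0"
| "sqrt_iteration B (Suc n) = (1/2) *\<^sub>R (B + (sqrt_iteration B n o\<^sub>L sqrt_iteration B n))"

lemma sqrt_iteration_nonneg_polynomial: "nonneg_polynomial B (sqrt_iteration B n)"
  by (induction n) (auto intro!: nonneg_polynomial.intros nonneg_polynomial_compose)

text \<open>The iteration is increasing, because with \<open>D = Y' - Y\<close> one has
  \<open>Y'\<^sup>2 - Y\<^sup>2 = D\<^sup>2 + D Y + Y D\<close>, so that nonnegativity of the coefficients passes from one
  increment to the next.\<close>

lemma sqrt_iteration_increment:
  "nonneg_polynomial B (sqrt_iteration B (Suc n) - sqrt_iteration B n)"
proof (induction n)
  case 0
  have "sqrt_iteration B (Suc 0) - sqrt_iteration B 0 = (1/2) *\<^sub>R B" by simp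
  then show ?case
    using nonneg_polynomial.scale[OF nonneg_polynomial.self, of "1/2" B] by simp
next
  case (Suc n)
  define Y where "Y = sqrt_iteration B n"
  define Y' where "Y' = sqrt_iteration B (Suc n)"
  define D where "D = Y' - Y"
  have D: "nonneg_polynomial B D" using Suc by (simp only: D_def Y_def Y'_def)
  have Y: "nonneg_polynomial B Y" by (simp add: Y_def sqrt_iteration_nonneg_polynomial)
  have "sqrt_iteration B (Suc (Suc n)) - sqrt_iteration B (Suc n)
      = (1/2) *\<^sub>R (B + (Y' o\<^sub>L Y')) - (1/2) *\<^sub>R (B + (Y o\<^sub>L Y))"
    by (simp add: Y_def Y'_def)
  also have "\<dots> = (1/2) *\<^sub>R ((D o\<^sub>L D) + ((D o\<^sub>L Y) + (Y o\<^sub>L D)))"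
    by (rule blinfun_eqI) (simp add: D_def blinfun.bilinear_simps algebra_simps)
  finally show ?case
    using D Y by (simp only:) (intro nonneg_polynomial.intros nonneg_polynomial_compose, simp_all)
qed

lemma sqrt_iteration_norm_le_1:
  assumes "norm B \<le> 1"
  shows "norm (sqrt_iteration B n) \<le> 1"
proof (induction n)
  case (Suc n)
  define Y where "Y = sqrt_iteration B n"
  have "norm (Y o\<^sub>L Y) \<le> 1"
    using norm_blinfun_compose[of Y Y] mult_le_one[of "norm Y" "norm Y"] Suc
    by (simp add: Y_def)
  then have "norm (B + (Y o\<^sub>L Y)) \<le> 2"
    using norm_triangle_ineq[of B "Y o\<^sub>L Y"] assms by linarith
  then show ?case by (simp add: Y_def)
qed simp

lemma sqrt_iteration_commute:
  assumes "\<And>x. blinfun_apply C (blinfun_apply B x) = B (C x)"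
  shows "C (sqrt_iteration B n x) = sqrt_iteration B n (C x)"
  by (induction n arbitrary: x) (simp_all add: blinfun.bilinear_simps assms)

text \<open>With \<open>B = 1 - A\<close> and \<open>Y\<close> the strong limit of the iteration, \<open>(1 - Y)\<^sup>2 = 1 - B = A\<close>. The
  convergence theorem applies to the decreasing operators \<open>Z\<^sub>n = 1 - Y\<^sub>n\<close>, which are positive because
  \<open>\<parallel>Y\<^sub>n\<parallel> \<le> 1\<close>. As a limit of polynomials in \<open>A\<close> the root commutes with all that commutes with \<open>A\<close>; this is
  recorded because uniqueness of the square root rests on it.\<close>

lemma positive_contraction_sqrt_exists:
  fixes A :: "'a::chilbert_space \<Rightarrow>\<^sub>L 'a"
  assumes A: "positive_op A" and "norm A \<le> 1"
  obtains S where "is_sqrt_op A S"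
    "\<And>C x. (\<And>x. blinfun_apply C (A x) = A (C x)) \<Longrightarrow> C (S x) = S (C x)"
proof -
  define B where "B = id_blinfun - A"
  have B: "positive_op B"
    unfolding B_def using assms
    by (intro positive_op_id_minus positive_op_complex_linear positive_op_selfadjoint)
  have normB: "norm B \<le> 1"
    using positive_op_Re[OF A]
    by (intro positive_op_norm_bound[OF B])
      (simp_all add: B_def blinfun.diff_left cinner.diff_right Re_cinner_self)
  define Y where "Y = sqrt_iteration B"
  have Y: "positive_op (Y n)" for n
    unfolding Y_def by (rule nonneg_polynomial_positive[OF sqrt_iteration_nonneg_polynomial B])
  define Z where "Z n = id_blinfun - Y n" for n
  have Z: "positive_op (Z n)" for n
    unfolding Z_def using Y
    by (intro positive_op_id_minus positive_op_complex_linear positive_op_selfadjoint)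
      (auto simp: Y_def sqrt_iteration_norm_le_1[OF normB])
  have "Z n - Z (Suc n) = Y (Suc n) - Y n" for n by (simp add: Z_def)
  then have dec: "positive_op (Z n - Z (Suc n))" for n
    using nonneg_polynomial_positive[OF sqrt_iteration_increment B] by (simp only: Y_def)
  obtain S where S: "positive_op S" and lim: "\<And>x. (\<lambda>n. Z n x) \<longlonglongrightarrow> S x"
    using positive_decreasing_converges[of Z, OF Z dec] by blast
  have Z_Suc: "Z (Suc n) x = Z n x + (1/2) *\<^sub>R (A x - Z n (Z n x))" for n x
    by (simp add: Z_def Y_def B_def blinfun.bilinear_simps algebra_simps
        flip: scaleR_add_left)
  have Z_norm: "norm (Z n) \<le> norm (Z 0)" for n
  proof (induction n)
    case (Suc n)
    have "norm (Z (Suc n)) \<le> norm (Z n)"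
      using positive_op_Re[OF dec[of n]]
      by (intro loewner_imp_norm_le Z) (simp add: blinfun.diff_left cinner.diff_right)
    with Suc show ?case by linarith
  qed simp
  \<comment> \<open>Products of strongly convergent sequences converge strongly when one factor is bounded in
    norm: \<open>Z\<^sub>n Z\<^sub>n x = Z\<^sub>n (Z\<^sub>n x - S x) + Z\<^sub>n S x\<close>.\<close>
  have lim2: "(\<lambda>n. Z n (Z n x)) \<longlonglongrightarrow> S (S x)" for x
  proof -
    have "(\<lambda>n. Z n (Z n x - S x)) \<longlonglongrightarrow> 0"
    proof (rule Lim_null_comparison)
      show "\<forall>\<^sub>F n in sequentially. norm (Z n (Z n x - S x)) \<le> norm (Z 0) * norm (Z n x - S x)"
        by (intro always_eventually allI order_trans[OF norm_blinfun] mult_right_mono Z_norm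
            norm_ge_zero)
      show "(\<lambda>n. norm (Z 0) * norm (Z n x - S x)) \<longlonglongrightarrow> 0"
        using lim[of x] by (intro tendsto_mult_right_zero tendsto_norm_zero) (simp add: LIM_zero)
    qed
    from tendsto_add[OF this lim[of "S x"]] show ?thesis by (simp add: blinfun.diff_right)
  qed
  have "S (S x) = A x" for x
  proof -
    have "(\<lambda>n. Z n x + (1/2) *\<^sub>R (A x - Z n (Z n x))) \<longlonglongrightarrow> S x + (1/2) *\<^sub>R (A x - S (S x))"
      by (intro tendsto_intros lim lim2)
    moreover have "(\<lambda>n. Z n x + (1/2) *\<^sub>R (A x - Z n (Z n x))) \<longlonglongrightarrow> S x"
      using LIMSEQ_Suc[OF lim[of x]] by (simp only: Z_Suc)
    ultimately have "S x + (1/2) *\<^sub>R (A x - S (S x)) = S x" by (rule LIMSEQ_unique)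
    then show ?thesis by simp
  qed
  then have "is_sqrt_op A S"
    using S by (auto simp: is_sqrt_op_def intro!: blinfun_eqI)
  moreover have "C (S x) = S (C x)" if C: "\<And>x. blinfun_apply C (A x) = A (C x)" for C x
  proof (rule LIMSEQ_unique)
    have "C (B x) = B (C x)" for x using C by (simp add: B_def blinfun.bilinear_simps)
    then have "C (Z n x) = Z n (C x)" for n
      by (simp add: Z_def Y_def blinfun.bilinear_simps sqrt_iteration_commute)
    then show "(\<lambda>n. Z n (C x)) \<longlonglongrightarrow> C (S x)"
      using blinfun.tendsto[OF tendsto_const lim[of x], of C] by simp
  qed (rule lim)
  ultimately show thesis by (rule that)
qed

text \<open>Scaling by \<open>\<parallel>A\<parallel> + 1\<close>, which is nonzero even for \<open>A = 0\<close>, reduces to contractions.\<close>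

lemma positive_sqrt_exists:
  fixes A :: "'a::chilbert_space \<Rightarrow>\<^sub>L 'a"
  assumes A: "positive_op A"
  obtains S where "is_sqrt_op A S"
    "\<And>C x. (\<And>x. blinfun_apply C (A x) = A (C x)) \<Longrightarrow> C (S x) = S (C x)"
proof -
  define M where "M = norm A + 1"
  have M: "M > 0" by (simp add: M_def add_nonneg_pos)
  define A' where "A' = (1/M) *\<^sub>R A"
  have "positive_op A'" using A M by (simp add: A'_def positive_op_algebra)
  moreover have "norm A' \<le> 1" using M by (simp add: A'_def M_def)
  ultimately obtain S where S: "is_sqrt_op A' S"
    and comm: "\<And>C x. (\<And>x. blinfun_apply C (A' x) = A' (C x)) \<Longrightarrow> C (S x) = S (C x)"
    using positive_contraction_sqrt_exists by blast
  have S2: "S (S x) = (1/M) *\<^sub>R A x" for x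
    using S by (metis A'_def is_sqrt_op_def blinfun_apply_blinfun_compose scaleR_blinfun.rep_eq)
  show thesis
  proof (rule that)
    show "is_sqrt_op A (sqrt M *\<^sub>R S)"
      unfolding is_sqrt_op_def
    proof
      show "positive_op (sqrt M *\<^sub>R S)"
        using S M by (simp add: is_sqrt_op_def positive_op_algebra)
      show "sqrt M *\<^sub>R S o\<^sub>L sqrt M *\<^sub>R S = A"
        using M by (intro blinfun_eqI) (simp add: blinfun.bilinear_simps S2)
    qed
    fix C x assume "\<And>x. blinfun_apply C (A x) = A (C x)"
    then have "C (S x) = S (C x)"
      by (intro comm) (simp add: A'_def blinfun.bilinear_simps)
    then show "C ((sqrt M *\<^sub>R S) x) = (sqrt M *\<^sub>R S) (C x)"
      by (simp add: blinfun.bilinear_simps)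
  qed
qed

text \<open>Let \<open>S\<close> be the root just constructed and \<open>T\<close> any root. Since \<open>T\<close> commutes with \<open>A = T\<^sup>2\<close>
  it commutes with \<open>S\<close>, so \<open>y = (S - T) x\<close> satisfies \<open>(S + T) y = (S\<^sup>2 - T\<^sup>2) x = 0\<close>. Both forms
  \<open>\<langle>y, S y\<rangle>\<close> and \<open>\<langle>y, T y\<rangle>\<close> are nonnegative, hence both vanish.\<close>

lemma positive_sqrt_ex1:
  fixes A :: "'a::chilbert_space \<Rightarrow>\<^sub>L 'a"
  assumes A: "positive_op A"
  shows "\<exists>!S. is_sqrt_op A S"
proof -
  obtain S where S: "is_sqrt_op A S"
    and comm: "\<And>C x. (\<And>x. blinfun_apply C (A x) = A (C x)) \<Longrightarrow> C (S x) = S (C x)"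
    using positive_sqrt_exists[OF A] by blast
  have posS: "positive_op S" and SS: "S (S x) = A x" for x
    using S by (auto simp: is_sqrt_op_def)
  have "T = S" if T: "is_sqrt_op A T" for T
  proof (rule blinfun_eqI)
    fix x
    have posT: "positive_op T" and TT: "T (T x) = A x" for x
      using T by (auto simp: is_sqrt_op_def)
    define y where "y = S x - T x"
    have "T (S x) = S (T x)"
      by (rule comm) (simp flip: TT)
    then have "S y + T y = 0"
      by (simp add: y_def blinfun.diff_right SS TT)
    then have "Re (cinner y (S y)) + Re (cinner y (T y)) = 0"
      by (metis cinner_add_right cinner.zero_right plus_complex.sel(1) zero_complex.sel(1))
    then have "Re (cinner y (S y)) = 0" "Re (cinner y (T y)) = 0"
      using positive_op_Re[OF posS, of y] positive_op_Re[OF posT, of y] by linarith+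
    then have "S y = 0" "T y = 0"
      using positive_op_norm_sq_le[OF posS, of y] positive_op_norm_sq_le[OF posT, of y]
      by simp_all
    moreover have "cinner y y = cinner (S y) x - cinner (T y) x"
      by (simp add: y_def cinner.diff_right flip: positive_op_selfadjoint[OF posS]
          positive_op_selfadjoint[OF posT])
    ultimately have "y = 0" by (simp add: cinner.zero_left cinner_self)
    then show "T x = S x" by (simp add: y_def)
  qed
  with S show ?thesis by blast
qed

lemma sqrt_op_is_sqrt: "positive_op A \<Longrightarrow> is_sqrt_op A (sqrt_op A)"
  unfolding sqrt_op_def by (rule theI'[OF positive_sqrt_ex1])

lemma is_sqrt_op_imp_eq_sqrt_op:
  assumes "is_sqrt_op A S"
  shows "S = sqrt_op A"
proof -
  have "positive_op A"
    using positive_op_algebra(5)[of id_blinfun S] assms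
    by (metis is_sqrt_op_def positive_op_algebra(1) blinfun_apply_blinfun_compose
        blinfun_apply_id_blinfun blinfun_eqI)
  then show ?thesis
    using positive_sqrt_ex1 sqrt_op_is_sqrt assms by blast
qed

section \<open>Parseval's identity and the trace\<close>

lemma norm_sq_diff_unit:
  fixes a s :: "'a::chilbert_space"
  assumes "cinner a a = 1"
  shows "(norm (s - c *\<^sub>C a))\<^sup>2 = (norm s)\<^sup>2 - (cmod (cinner a s))\<^sup>2 + (cmod (cinner a s - c))\<^sup>2"
proof -
  have "cinner (s - c *\<^sub>C a) (s - c *\<^sub>C a)
      = cinner s s - c * cnj (cinner a s) - cnj c * cinner a s + c * cnj c"
    using assms cinner_commute[of s a]
    by (simp add: cinner.diff_left cinner.diff_right cinner_scaleC_left cinner_scaleC_right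
        algebra_simps)
  then have "(norm (s - c *\<^sub>C a))\<^sup>2
      = Re (cinner s s - c * cnj (cinner a s) - cnj c * cinner a s + c * cnj c)"
    by (simp only: flip: Re_cinner_self)
  then show ?thesis
    by (simp add: Re_cinner_self cmod_power2) (simp add: power2_eq_square algebra_simps)
qed

text \<open>The last sum vanishes when the \<open>c e\<close> are the Fourier coefficients, which yields Bessel's
  inequality. Since it is nonnegative in general, no other combination of the vectors in \<open>F\<close> comes
  closer to \<open>x\<close>.\<close>

lemma norm_sq_diff_orthonormal_sum:
  fixes x :: "'a::chilbert_space"
  assumes "finite F" "\<forall>e\<in>F. \<forall>f\<in>F. cinner e f = (if e = f then 1 else 0)"
  shows "(norm (x - (\<Sum>e\<in>F. c e *\<^sub>C e)))\<^sup>2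
    = (norm x)\<^sup>2 - (\<Sum>e\<in>F. (cmod (cinner e x))\<^sup>2) + (\<Sum>e\<in>F. (cmod (cinner e x - c e))\<^sup>2)"
  using assms
proof (induction F rule: finite_induct)
  case (insert a F)
  define s where "s = x - (\<Sum>e\<in>F. c e *\<^sub>C e)"
  have a: "cinner a a = 1" using insert.prems by simp
  have "cinner a e = 0" if "e \<in> F" for e
    using insert.prems insert.hyps that by (metis insertCI)
  then have as: "cinner a s = cinner a x"
    by (simp add: s_def cinner.diff_right cinner.sum_right cinner_scaleC_right)
  have split: "x - (\<Sum>e\<in>insert a F. c e *\<^sub>C e) = s - c a *\<^sub>C a"
    using insert.hyps by (simp add: s_def algebra_simps)
  have IH: "(norm s)\<^sup>2 = (norm x)\<^sup>2 - (\<Sum>e\<in>F. (cmod (cinner e x))\<^sup>2)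
      + (\<Sum>e\<in>F. (cmod (cinner e x - c e))\<^sup>2)"
    unfolding s_def using insert by blast
  show ?case
    unfolding split norm_sq_diff_unit[OF a] as IH using insert.hyps by simp
qed simp

text \<open>Bessel's inequality bounds the sum from above. Conversely a vector of the span within
  \<open>\<epsilon>\<close> of \<open>x\<close> lies in the span of finitely many basis vectors, and the best approximation property
  shows that these alone already account for \<open>\<parallel>x\<parallel>\<^sup>2\<close> up to \<open>\<epsilon>\<^sup>2\<close>. The basis may be uncountable.\<close>

lemma parseval:
  fixes x :: "'a::chilbert_space"
  assumes B: "orthonormal_basis B"
  shows "((\<lambda>e. (cmod (cinner e x))\<^sup>2) has_sum (norm x)\<^sup>2) B"
proof -
  define f where "f e = (cmod (cinner e x))\<^sup>2" for e
  have on: "\<forall>e\<in>F. \<forall>g\<in>F. cinner e g = (if e = g then 1 else 0)" if "F \<subseteq> B" for F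
    using B that unfolding orthonormal_basis_def by blast
  have bessel: "sum f F \<le> (norm x)\<^sup>2" if "finite F" "F \<subseteq> B" for F
  proof -
    have "0 \<le> (norm (x - (\<Sum>e\<in>F. cinner e x *\<^sub>C e)))\<^sup>2" by simp
    also have "\<dots> = (norm x)\<^sup>2 - sum f F"
      using norm_sq_diff_orthonormal_sum[OF that(1) on[OF that(2)], of x "\<lambda>e. cinner e x"]
      by (simp add: f_def)
    finally show ?thesis by simp
  qed
  have "f summable_on B"
    by (rule nonneg_bdd_above_summable_on)
      (auto simp: f_def intro!: bdd_aboveI2[where M = "(norm x)\<^sup>2"] bessel[unfolded f_def])
  then obtain S where S: "(f has_sum S) B" by (auto simp: summable_on_def)
  have "S \<le> (norm x)\<^sup>2" by (rule has_sum_le_finite_sums[OF S bessel])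
  moreover have "(norm x)\<^sup>2 \<le> S"
  proof (rule field_le_epsilon)
    fix e :: real assume e: "e > 0"
    have "x \<in> closure (cspan B)" using B by (simp add: orthonormal_basis_def)
    then obtain y where "y \<in> cspan B" and y: "dist y x < sqrt e"
      using e unfolding closure_approachable by (meson real_sqrt_gt_zero)
    then obtain F c where F: "finite F" "F \<subseteq> B" and y_eq: "y = (\<Sum>e\<in>F. c e *\<^sub>C e)"
      unfolding complex_vector.span_explicit by blast
    have "(norm x)\<^sup>2 - sum f F \<le> (norm (x - y))\<^sup>2"
      unfolding y_eq norm_sq_diff_orthonormal_sum[OF F(1) on[OF F(2)]]
      by (simp add: f_def sum_nonneg)
    also have "\<dots> \<le> (sqrt e)\<^sup>2"
      using y by (intro power_mono) (auto simp: dist_norm norm_minus_commute)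
    also have "\<dots> = e" using e by simp
    finally have "(norm x)\<^sup>2 - sum f F \<le> e" .
    moreover have "sum f F \<le> S"
      by (rule finite_sum_le_has_sum[OF S F]) (simp add: f_def)
    ultimately show "(norm x)\<^sup>2 \<le> S + e" by linarith
  qed
  ultimately have "S = (norm x)\<^sup>2" by simp
  with S show ?thesis unfolding f_def by simp
qed

lemma nonneg_has_sum_interchange:
  fixes f :: "'i \<Rightarrow> 'j \<Rightarrow> real"
  assumes nonneg: "\<And>x y. x \<in> A \<Longrightarrow> y \<in> C \<Longrightarrow> 0 \<le> f x y"
    and rows: "\<And>x. x \<in> A \<Longrightarrow> ((\<lambda>y. f x y) has_sum g x) C"
    and cols: "\<And>y. y \<in> C \<Longrightarrow> ((\<lambda>x. f x y) has_sum h y) A"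
    and g: "(g has_sum S) A"
  shows "(h has_sum S) C"
proof -
  have "(\<lambda>(x, y). f x y) summable_on A \<times> C"
    using rows g nonneg by (intro summable_on_SigmaI[where g = g]) (auto simp: summable_on_def)
  then have "((\<lambda>(x, y). f x y) has_sum S) (A \<times> C)"
    using rows g by (intro has_sum_SigmaI[where g = g]) auto
  then have "((\<lambda>(y, x). f x y) has_sum S) (C \<times> A)"
    by (subst (asm) has_sum_swap) (simp add: case_prod_unfold)
  then show ?thesis
    by (rule has_sum_SigmaD) (use cols in auto)
qed

text \<open>Both sums equal the double sum of \<open>\<bar>\<langle>E\<^sub>n, e\<rangle>\<bar>\<^sup>2\<close>, by Parseval's identity for each \<open>E\<^sub>n\<close>.
  In particular finiteness for one basis gives finiteness and the same value for every basis.\<close>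

lemma diagonal_has_sum_iff:
  fixes D :: "'a::chilbert_space \<Rightarrow>\<^sub>L 'a"
  assumes B: "orthonormal_basis B"
    and form: "\<And>x. (\<lambda>n. (cmod (cinner (E n) x))\<^sup>2) sums Re (cinner x (D x))"
  shows "((\<lambda>e. Re (cinner e (D e))) has_sum S) B \<longleftrightarrow> ((\<lambda>n. (norm (E n))\<^sup>2) has_sum S) UNIV"
proof -
  define f where "f e n = (cmod (cinner (E n) e))\<^sup>2" for e n
  have rows: "((\<lambda>n. f e n) has_sum Re (cinner e (D e))) UNIV" for e
    unfolding f_def by (rule sums_nonneg_imp_has_sum[OF form]) simp
  have f_eq: "f e n = (cmod (cinner e (E n)))\<^sup>2" for e n
    by (metis f_def cinner_commute complex_mod_cnj)
  have cols: "((\<lambda>e. f e n) has_sum (norm (E n))\<^sup>2) B" for n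
    unfolding f_eq by (rule parseval[OF B])
  have nonneg: "0 \<le> f e n" for e n by (simp add: f_def)
  show ?thesis
  proof
    assume "((\<lambda>e. Re (cinner e (D e))) has_sum S) B"
    with nonneg rows cols show "((\<lambda>n. (norm (E n))\<^sup>2) has_sum S) UNIV"
      by (rule nonneg_has_sum_interchange)
  next
    assume "((\<lambda>n. (norm (E n))\<^sup>2) has_sum S) UNIV"
    with nonneg cols rows show "((\<lambda>e. Re (cinner e (D e))) has_sum S) B"
      by (rule nonneg_has_sum_interchange[where f = "\<lambda>n e. f e n"])
  qed
qed

lemma abs_op_positive:
  fixes A :: "'a::chilbert_space \<Rightarrow>\<^sub>L 'a"
  assumes A: "positive_op A"
  shows "abs_op A = A"
proof -
  have "adjoint_op A = A"
    unfolding adjoint_op_def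
  proof (rule the_equality)
    show "\<forall>x y. cinner x (A y) = cinner (A x) y"
      using positive_op_selfadjoint[OF A] by blast
    fix C :: "'a \<Rightarrow>\<^sub>L 'a"
    assume C: "\<forall>x y. cinner x (A y) = cinner (C x) y"
    show "C = A"
    proof (rule blinfun_eqI)
      fix x
      have "cinner (C x - A x) y = 0" for y
        using C positive_op_selfadjoint[OF A, of x y] by (simp add: cinner.diff_left)
      then have "C x - A x = 0" using cinner_self[of "C x - A x"] by simp
      then show "C x = A x" by simp
    qed
  qed
  moreover have "is_sqrt_op (A o\<^sub>L A) A" using A by (simp add: is_sqrt_op_def)
  ultimately show ?thesis
    unfolding abs_op_def by (simp flip: is_sqrt_op_imp_eq_sqrt_op)
qed

text \<open>A positive operator is its own absolute value.\<close>

lemma trace_class_positive_iff: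
  fixes A :: "'a::chilbert_space \<Rightarrow>\<^sub>L 'a"
  assumes A: "positive_op A"
  shows "trace_class A \<longleftrightarrow> (\<exists>B. orthonormal_basis B \<and> (\<lambda>e. Re (cinner e (A e))) summable_on B)"
proof -
  have eq: "(\<lambda>e. cinner e (A e)) = (\<lambda>e. complex_of_real (Re (cinner e (A e))))"
    using positive_op_cinner_real[OF A] by (intro ext)
  have "(\<lambda>e. cinner e (A e)) summable_on B \<longleftrightarrow> (\<lambda>e. Re (cinner e (A e))) summable_on B" for B
  proof
    assume "(\<lambda>e. Re (cinner e (A e))) summable_on B"
    then show "(\<lambda>e. cinner e (A e)) summable_on B"
      by (subst eq) (rule summable_on_of_real)
  qed (rule summable_on_Re)
  then show ?thesis
    by (simp add: trace_class_def abs_op_positive[OF A] positive_op_complex_linear[OF A])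
qed

lemma trace_of_rank_one_series:
  fixes D :: "'a::chilbert_space \<Rightarrow>\<^sub>L 'a"
  assumes D: "positive_op D" and tc: "trace_class D"
    and form: "\<And>x. (\<lambda>n. (cmod (cinner (E n) x))\<^sup>2) sums Re (cinner x (D x))"
  shows "(\<lambda>n. complex_of_real ((norm (E n))\<^sup>2)) sums trace_op D"
proof -
  obtain B where B: "orthonormal_basis B" and "(\<lambda>e. Re (cinner e (D e))) summable_on B"
    using tc trace_class_positive_iff[OF D] by blast
  then obtain S where "((\<lambda>e. Re (cinner e (D e))) has_sum S) B"
    by (auto simp: summable_on_def)
  then have S: "((\<lambda>n. (norm (E n))\<^sup>2) has_sum S) UNIV"
    using diagonal_has_sum_iff[OF B form] by blast
  \<comment> \<open>The basis in the definition of the trace need not be \<open>B\<close>; the passage through \<open>E\<close> carries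
    the value \<open>S\<close> over to it.\<close>
  define B' :: "'a set" where "B' = (SOME B. orthonormal_basis B)"
  have B': "orthonormal_basis B'" unfolding B'_def using B by (rule someI)
  have "((\<lambda>e. Re (cinner e (D e))) has_sum S) B'"
    using diagonal_has_sum_iff[OF B' form] S by blast
  then have "((\<lambda>e. complex_of_real (Re (cinner e (D e)))) has_sum complex_of_real S) B'"
    by (rule has_sum_of_real)
  then have "trace_op D = complex_of_real S"
    unfolding trace_op_def B'_def[symmetric] positive_op_cinner_real[OF D, symmetric]
    by (rule infsumI)
  moreover have "(\<lambda>n. complex_of_real ((norm (E n))\<^sup>2)) sums complex_of_real S"
    using has_sum_imp_sums[OF S] by (rule sums_of_real)
  ultimately show ?thesis by simp
qed

section \<open>The residual recursion\<close>

lemma rank_one_form: "cinner x (rank_one a a x) = complex_of_real ((cmod (cinner a x))\<^sup>2)"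
  using cinner_commute[of x a]
  by (simp add: rank_one_apply cinner_scaleC_right flip: complex_norm_square)

lemma positive_op_rank_one: "positive_op (rank_one a a)"
proof (rule positive_opI)
  show "complex_linear (rank_one a a)"
    by (simp add: complex_linear_def rank_one_apply cinner_scaleC_right scaleC_scaleC)
  show "cinner x (rank_one a a y) = cinner (rank_one a a x) y" for x y
    using cinner_commute[of x a]
    by (simp add: rank_one_apply cinner_scaleC_right cinner_scaleC_left)
  show "0 \<le> Re (cinner x (rank_one a a x))" for x by (simp add: rank_one_form)
qed

lemma positive_op_id_minus_rank_one:
  fixes u :: "'a::chilbert_space"
  assumes "norm u = 1"
  shows "positive_op (id_blinfun - rank_one u u)"
proof (rule positive_op_id_minus)
  show "norm (rank_one u u) \<le> 1"
    using cinner_Cauchy_Schwarz[of u] assms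
    by (intro norm_blinfun_bound) (auto simp: rank_one_apply norm_scaleC)
qed (use positive_op_rank_one positive_op_complex_linear positive_op_selfadjoint in blast)+

text \<open>Because \<open>S\<close> is self-adjoint, \<open>S \<bar>u\<rangle>\<langle>u\<bar> S = \<bar>S u\<rangle>\<langle>S u\<bar>\<close>. The identity turns the partial sums of
  the rank-one series into telescoping sums.\<close>

lemma residual_step_eq_diff:
  fixes u :: "'a::chilbert_space"
  assumes "is_sqrt_op R S"
  shows "S o\<^sub>L (id_blinfun - rank_one u u) o\<^sub>L S = R - rank_one (S u) (S u)"
proof (rule blinfun_eqI)
  fix x
  have S: "positive_op S" and SS: "S (S x) = R x"
    using assms by (auto simp: is_sqrt_op_def)
  show "(S o\<^sub>L (id_blinfun - rank_one u u) o\<^sub>L S) x = (R - rank_one (S u) (S u)) x"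
    by (simp add: blinfun.bilinear_simps rank_one_apply SS
        complex_linearD[OF positive_op_complex_linear[OF S]] positive_op_selfadjoint[OF S])
qed

lemma residual_update_positive:
  assumes "positive_op R" "norm u = 1"
  shows "positive_op (residual_update u R)"
  unfolding residual_update_def
  using sqrt_op_is_sqrt[OF assms(1)] assms(2)
  by (intro positive_op_algebra positive_op_id_minus_rank_one) (simp_all add: is_sqrt_op_def)

theorem theorem3p4:
  fixes R0 :: "'a::chilbert_space \<Rightarrow>\<^sub>L 'a"
    and u :: "nat \<Rightarrow> 'a"
    and R :: "nat \<Rightarrow> 'a \<Rightarrow>\<^sub>L 'a"
    and E :: "nat \<Rightarrow> 'a"
  assumes "positive_op R0"
    and "\<And>n. norm (u n) = 1"
    and "R 0 = R0"
    and "\<And>n. R (Suc n) = residual_update (u n) (R n)"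
    and "\<And>n. E n = sqrt_op (R n) (u n)"
  shows "(\<exists>!Rinf. is_residual_limit R Rinf) \<and>
    (\<forall>Rinf. is_residual_limit R Rinf \<longrightarrow>
      (\<forall>n. R (Suc n) \<le>\<^sub>L R n \<and> Rinf \<le>\<^sub>L R (Suc n)) \<and>
      limitin strong_operator_topology R Rinf sequentially \<and>
      (\<forall>x. (\<lambda>n. complex_of_real ((cmod (cinner (E n) x))\<^sup>2)) sums cinner x ((R0 - Rinf) x)) \<and>
      limitin strong_operator_topology (\<lambda>N. \<Sum>n<N. rank_one (E n) (E n)) (R0 - Rinf) sequentially \<and>
      (trace_class R0 \<longrightarrow>
        trace_class (R0 - Rinf) \<and>
        (\<lambda>n. complex_of_real ((norm (E n))\<^sup>2)) sums trace_op (R0 - Rinf))) \<and>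
    (\<exists>S. residual_run R0 u R S E) \<and>
    (\<forall>R' S' E'. residual_run R0 u R' S' E' \<longrightarrow>
      (\<forall>n. E' n = E n \<and> rank_one (E' n) (E' n) = rank_one (E n) (E n)))"
proof -
  have pos: "positive_op (R n)" for n
    by (induction n) (simp_all add: assms residual_update_positive)
  have sqrt: "is_sqrt_op (R n) (sqrt_op (R n))" for n
    by (rule sqrt_op_is_sqrt[OF pos])
  have diff: "R (Suc n) = R n - rank_one (E n) (E n)" for n
    unfolding assms(4,5) residual_update_def by (rule residual_step_eq_diff[OF sqrt])
  have dec: "positive_op (R n - R (Suc n))" for n
    by (simp add: diff positive_op_rank_one)
  have partial: "(\<Sum>n<N. rank_one (E n) (E n)) = R0 - R N" for N
    by (induction N) (simp_all add: assms(3) diff)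
  obtain L where L: "positive_op L" and lim: "\<And>x. (\<lambda>n. R n x) \<longlonglongrightarrow> L x"
    using positive_decreasing_converges[of R, OF pos dec] by blast
  have limL: "is_residual_limit R L"
    unfolding is_residual_limit_def using L by (auto intro!: cinner.tendsto tendsto_const lim)
  have unique: "Rinf = L" if "is_residual_limit R Rinf" for Rinf
  proof (rule quadratic_form_inject)
    show "cinner x (Rinf x) = cinner x (L x)" for x
      using that limL unfolding is_residual_limit_def by (meson LIMSEQ_unique)
  qed (use that L in \<open>auto simp: is_residual_limit_def positive_op_complex_linear\<close>)
  have step: "cinner x (R (Suc n) x) \<le> cinner x (R n x)" for n x
    using dec[of n]
    by (simp add: positive_op_def blinfun.diff_left cinner.diff_right less_eq_complex_def)
  have below: "cinner x (L x) \<le> cinner x (R n x)" for n x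
  proof -
    have "decseq (\<lambda>n. Re (cinner x (R n x)))"
      using step by (intro decseq_SucI) (simp add: less_eq_complex_def)
    moreover have "(\<lambda>n. Re (cinner x (R n x))) \<longlonglongrightarrow> Re (cinner x (L x))"
      by (intro tendsto_Re cinner.tendsto tendsto_const lim)
    ultimately have "Re (cinner x (L x)) \<le> Re (cinner x (R n x))" by (rule decseq_ge)
    then show ?thesis
      using L pos[of n] by (simp add: positive_op_def less_eq_complex_def)
  qed
  define D where "D = R0 - L"
  have D: "positive_op D"
  proof (rule positive_opI)
    show "complex_linear D"
      unfolding D_def using L assms(1) by (simp add: complex_linear_algebra positive_op_complex_linear)
    show "cinner x (D y) = cinner (D x) y" for x y
      using positive_op_selfadjoint[OF L] positive_op_selfadjoint[OF assms(1)]
      by (simp add: D_def blinfun.diff_left cinner.diff_left cinner.diff_right)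
    show "0 \<le> Re (cinner x (D x))" for x
      using below[of x 0]
      by (simp add: D_def assms(3) blinfun.diff_left cinner.diff_right less_eq_complex_def)
  qed
  have series: "(\<lambda>N. (\<Sum>n<N. rank_one (E n) (E n)) x) \<longlonglongrightarrow> D x" for x
    unfolding partial D_def blinfun.diff_left by (intro tendsto_diff tendsto_const lim)
  have form: "(\<lambda>n. complex_of_real ((cmod (cinner (E n) x))\<^sup>2)) sums cinner x (D x)" for x
    using cinner.tendsto[OF tendsto_const series[of x], of x]
    by (simp add: sums_def blinfun.sum_left cinner.sum_right rank_one_form)
  have form_Re: "(\<lambda>n. (cmod (cinner (E n) x))\<^sup>2) sums Re (cinner x (D x))" for x
    using sums_Re[OF form[of x]] by simp
  have trace: "trace_class D \<and> (\<lambda>n. complex_of_real ((norm (E n))\<^sup>2)) sums trace_op D"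
    if tc: "trace_class R0"
  proof -
    obtain B where B: "orthonormal_basis B" and sm: "(\<lambda>e. Re (cinner e (R0 e))) summable_on B"
      using tc trace_class_positive_iff[OF assms(1)] by blast
    \<comment> \<open>Since \<open>0 \<le> D \<le> R\<^sub>0\<close>, the diagonal of \<open>D\<close> is dominated by that of \<open>R\<^sub>0\<close>.\<close>
    have "(\<lambda>e. Re (cinner e (D e))) summable_on B"
      by (rule summable_on_comparison_test[OF sm])
        (use positive_op_Re[OF L] positive_op_Re[OF D] in
          \<open>auto simp: D_def blinfun.diff_left cinner.diff_right\<close>)
    then have "trace_class D" using B trace_class_positive_iff[OF D] by blast
    then show ?thesis using trace_of_rank_one_series[OF D _ form_Re] by blast
  qed
  have limit_props: "(\<forall>n. R (Suc n) \<le>\<^sub>L R n \<and> Rinf \<le>\<^sub>L R (Suc n)) \<and>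
      limitin strong_operator_topology R Rinf sequentially \<and>
      (\<forall>x. (\<lambda>n. complex_of_real ((cmod (cinner (E n) x))\<^sup>2)) sums cinner x ((R0 - Rinf) x)) \<and>
      limitin strong_operator_topology (\<lambda>N. \<Sum>n<N. rank_one (E n) (E n)) (R0 - Rinf) sequentially \<and>
      (trace_class R0 \<longrightarrow>
        trace_class (R0 - Rinf) \<and>
        (\<lambda>n. complex_of_real ((norm (E n))\<^sup>2)) sums trace_op (R0 - Rinf))"
    if "is_residual_limit R Rinf" for Rinf
    unfolding unique[OF that] using pos L step below form trace lim series
    by (auto simp: loewner_le_def D_def intro!: limitin_strong_operator_topologyI)
  have run: "residual_run R0 u R (\<lambda>n. sqrt_op (R n)) E"
    using sqrt assms(3-5) by (simp add: residual_run_def residual_update_def)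
  have run_unique: "E' n = E n" if run: "residual_run R0 u R' S' E'" for R' S' E' n
  proof -
    have S': "S' n = sqrt_op (R' n)" for n
      using run by (intro is_sqrt_op_imp_eq_sqrt_op) (simp add: residual_run_def)
    have "R' n = R n"
    proof (induction n)
      case (Suc n)
      then show ?case
        using run assms(4)[of n] S'[of n] by (simp add: residual_run_def residual_update_def)
    qed (use run assms(3) in \<open>simp add: residual_run_def\<close>)
    then show ?thesis using run S'[of n] assms(5)[of n] by (simp add: residual_run_def)
  qed
  have "\<exists>!Rinf. is_residual_limit R Rinf"
    using limL unique by (rule ex1I)
  then show ?thesis
  proof (intro conjI)
    show "\<exists>S. residual_run R0 u R S E" using run by blast
    show "\<forall>R' S' E'. residual_run R0 u R' S' E' \<longrightarrow>
        (\<forall>n. E' n = E n \<and> rank_one (E' n) (E' n) = rank_one (E n) (E n))"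
    proof (intro allI impI)
      fix R' S' E' n
      assume "residual_run R0 u R' S' E'"
      then have "E' n = E n" by (rule run_unique)
      then show "E' n = E n \<and> rank_one (E' n) (E' n) = rank_one (E n) (E n)" by simp
    qed
  qed (assumption, intro allI impI, rule limit_props)
qed

end
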